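(* Let $k\ge3$, let $\mathcal{H}$ be a connected $k$-uniform hypergraph on vertex set $[n]$, and let $b_i>0$ for each $i\in[n]$. For $i\in[n]$ put $$b'_i=b_i^{-(k-1)}\sum_{e\in E(\mathcal{H}),\, i\in e}\ \prod_{v\in e\setminus\{i\}} b_v .$$ Then $$\min_{e\in E(\mathcal{H})}\min_{\{i,j\}\subseteq e}\sqrt{b'_ib'_j}\le\rho(\mathbb{A}(\mathcal{H}))\le\max_{e\in E(\mathcal{H})}\max_{\{i,j\}\subseteq e}\sqrt{b'_ib'_j}.$$ Moreover, one of these equalities holds if and only if $b'_i=b'_j$ for all $i,j\in[n]$.
   Context: A $k$-uniform hypergraph $\mathcal{H}$ has vertex set $[n]=\{1,\ldots,n\}$ and edge set $E(\mathcal{H})$ consisting of $k$-element subsets of $[n]$. It is connected if any two vertices are joined by a walk $v_0,e_1,v_1,\ldots,e_\ell,v_\ell$ with $\{v_{i},v_{i+1}\}\subseteq e_{i+1}$. The adjacency tensor $\mathbb{A}(\mathcal{H})$ is the order $k$ dimension $n$ tensor with entry $\frac{1}{(k-1)!}$ at $(i_1,\ldots,i_k)$ if $\{i_1,\ldots,i_k\}\in E(\mathcal{H})$ and $0$ otherwise. For an order $k$ dimension $n$ tensor $\mathbb{T}$, $\lambda\in\mathbb{C}$ is an eigenvalue if there is nonzero $X\in\mathbb{C}^n$ with $\sum_{i_2,\ldots,i_k}t_{ii_2\ldots i_k}x_{i_2}\cdots x_{i_k}=\lambda x_i^{k-1}$ for all $i$; $\rho(\mathbb{T})$ is the maximum modulus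 of eigenvalues. *)

theory Defs
  imports "HOL-Analysis.Analysis"
begin

text \<open>
  The vertex set \<open>[n]\<close> is a finite type \<open>'n\<close> with \<open>n = CARD('n)\<close>, and a hypergraph is given
  by its edge set \<open>E :: 'n set set\<close>.
\<close>

definition uniform_hypergraph :: "nat \<Rightarrow> 'n set set \<Rightarrow> bool" where
  "uniform_hypergraph k E \<longleftrightarrow> (\<forall>e\<in>E. card e = k)"

text \<open>The walk \<open>v\<^sub>0, e\<^sub>1, v\<^sub>1, \<dots>, e\<^sub>l, v\<^sub>l\<close> is the pair of lists \<open>[v\<^sub>0, \<dots>, v\<^sub>l]\<close>, \<open>[e\<^sub>1, \<dots>, e\<^sub>l]\<close>.\<close>

definition hypergraph_walk :: "'n set set \<Rightarrow> 'n list \<Rightarrow> 'n set list \<Rightarrow> bool" where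
  "hypergraph_walk E vs es \<longleftrightarrow>
     length vs = length es + 1 \<and>
     (\<forall>i<length es. es ! i \<in> E \<and> {vs ! i, vs ! (i + 1)} \<subseteq> es ! i)"

definition connected_hypergraph :: "'n set set \<Rightarrow> bool" where
  "connected_hypergraph E \<longleftrightarrow>
     (\<forall>u v. \<exists>vs es. hypergraph_walk E vs es \<and> hd vs = u \<and> last vs = v)"

text \<open>
  A tensor of order \<open>k\<close> and dimension \<open>CARD('n)\<close> is a function on index lists of which only the
  values at lists of length \<open>k\<close> matter.
\<close>

type_synonym 'n tensor = "'n list \<Rightarrow> complex"

definition adjacency_tensor :: "nat \<Rightarrow> 'n set set \<Rightarrow> 'n tensor" where
  "adjacency_tensor k E = (\<lambda>is. if length is = k \<and> set is \<in> E then 1 / fact (k - 1) else 0)"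

definition tensor_eigenvalue :: "nat \<Rightarrow> ('n::finite) tensor \<Rightarrow> complex \<Rightarrow> bool" where
  "tensor_eigenvalue k T l \<longleftrightarrow>
     (\<exists>x :: complex ^ 'n. x \<noteq> 0 \<and>
        (\<forall>i. (\<Sum>js | length js = k - 1. T (i # js) * (\<Prod>j\<leftarrow>js. x $ j)) = l * (x $ i) ^ (k - 1)))"

definition tensor_spectral_radius :: "nat \<Rightarrow> ('n::finite) tensor \<Rightarrow> real" where
  "tensor_spectral_radius k T = (GREATEST r. \<exists>l. tensor_eigenvalue k T l \<and> r = cmod l)"

definition weighted_degree :: "nat \<Rightarrow> ('n::finite) set set \<Rightarrow> ('n \<Rightarrow> real) \<Rightarrow> 'n \<Rightarrow> real" where
  "weighted_degree k E b i =
     inverse (b i ^ (k - 1)) * (\<Sum>e | e \<in> E \<and> i \<in> e. \<Prod>v\<in>e - {i}. b v)"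

end

theory Submission
  imports Defs "HOL-Combinatorics.Multiset_Permutations"
begin

text \<open>
  Maximizing \<open>\<Sum>e\<in>E. \<Prod>v\<in>e. x v\<close> against \<open>\<Sum>v. x v ^ k\<close> on the nonnegative orthant yields,
  by connectedness, a positive critical point \<open>x\<close>, that is, a positive eigenvector; comparing the
  moduli of any other eigenvector with a multiple of \<open>x\<close> shows that its eigenvalue is the spectral
  radius \<open>\<rho>\<close>. Put \<open>y v = x v / b v\<close>. If \<open>i\<close> maximizes \<open>y\<close> and \<open>j\<close> maximizes \<open>y\<close> among the
  neighbours of \<open>i\<close>, the eigenvalue equations at \<open>i\<close> and \<open>j\<close> give
  \<open>\<rho> * y i ^ (k - 1) \<le> b' i * y j ^ (k - 1)\<close> and \<open>\<rho> * y j ^ (k - 1) \<le> b' j * y i ^ (k - 1)\<close>, and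
  multiplying them bounds \<open>\<rho>\<^sup>2\<close> by \<open>b' i * b' j\<close>. Equality makes \<open>y\<close> constant on the edges at
  \<open>i\<close>, hence everywhere by connectedness. Minimizing instead gives the lower bound.
\<close>

section \<open>Link sums and the edge polynomial\<close>

text \<open>This is component \<open>i\<close> of the adjacency tensor applied to \<open>x\<close>
  and, for real \<open>x\<close>, the partial derivative of \<open>edge_sum E\<close> in the
  variable at \<open>i\<close>. The polymorphic type serves complex eigenvectors and real weights
  alike.\<close>

definition link_sum :: "('n::finite) set set \<Rightarrow> ('n \<Rightarrow> 'a::comm_semiring_1) \<Rightarrow> 'n \<Rightarrow> 'a" where
  "link_sum E x i = (\<Sum>e | e \<in> E \<and> i \<in> e. \<Prod>v\<in>e - {i}. x v)"

text \<open>For a \<open>k\<close>-uniform \<open>E\<close> with \<open>k \<ge> 1\<close>, the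
  degree \<open>k\<close> form of the adjacency tensor is \<open>k\<close> times this
  polynomial.\<close>

definition edge_sum :: "('n::finite) set set \<Rightarrow> ('n \<Rightarrow> real) \<Rightarrow> real" where
  "edge_sum E x = (\<Sum>e\<in>E. \<Prod>v\<in>e. x v)"

section \<open>Connectedness as a closure principle\<close>

text \<open>Induction along a walk from \<open>u\<close> to \<open>w\<close>. Every later use of
  connectedness goes through this principle.\<close>

lemma connected_hypergraph_closed_set:
  assumes "connected_hypergraph E" and "u \<in> S"
    and closed: "\<And>e v w. e \<in> E \<Longrightarrow> v \<in> e \<Longrightarrow> w \<in> e \<Longrightarrow> v \<in> S \<Longrightarrow> w \<in> S"
  shows "w \<in> S"
proof -
  obtain vs es where walk: "hypergraph_walk E vs es" "hd vs = u" "last vs = w"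
    using assms(1) unfolding connected_hypergraph_def by blast
  have len: "length vs = length es + 1"
    using walk(1) by (simp add: hypergraph_walk_def)
  have "i \<le> length es \<Longrightarrow> vs ! i \<in> S" for i
  proof (induction i)
    case 0
    then show ?case using walk(2) \<open>u \<in> S\<close> len by (cases vs) auto
  next
    case (Suc i)
    then have "es ! i \<in> E" "{vs ! i, vs ! (i + 1)} \<subseteq> es ! i"
      using walk(1) by (auto simp: hypergraph_walk_def)
    with Suc closed[of "es ! i" "vs ! i" "vs ! Suc i"] show ?case by simp
  qed
  from this[of "length es"] show ?thesis
    using walk(3) len last_conv_nth[of vs] by (cases "vs = []") auto
qed

text \<open>The union of all edges is nonempty and closed under adjacency, hence contains every
  vertex.\<close>

lemma connected_hypergraph_vertex_covered:
  assumes "connected_hypergraph E" "E \<noteq> {}" "\<And>e. e \<in> E \<Longrightarrow> e \<noteq> {}"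
  obtains e where "e \<in> E" "i \<in> e"
proof -
  obtain e u where "e \<in> E" "u \<in> e" using assms(2,3) by blast
  then have "u \<in> \<Union>E" by blast
  then have "i \<in> \<Union>E"
    by (rule connected_hypergraph_closed_set[OF assms(1)]) blast
  then show ?thesis using that by blast
qed

section \<open>Monotonicity and homogeneity\<close>

lemma link_sum_mono:
  fixes x y :: "'n::finite \<Rightarrow> real"
  assumes "\<And>e v. e \<in> E \<Longrightarrow> i \<in> e \<Longrightarrow> v \<in> e - {i} \<Longrightarrow> 0 \<le> x v \<and> x v \<le> y v"
  shows "link_sum E x i \<le> link_sum E y i"
  unfolding link_sum_def using assms by (intro sum_mono prod_mono) auto

text \<open>A strict inequality at one neighbour \<open>w\<close> makes the product over its edge
  strictly larger for \<open>y\<close>, because the remaining factors are positive; no other product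
  gets smaller, so the sums would differ.\<close>

lemma link_sum_eq_imp_eq:
  fixes x y :: "'n::finite \<Rightarrow> real"
  assumes le: "\<And>e v. e \<in> E \<Longrightarrow> i \<in> e \<Longrightarrow> v \<in> e - {i} \<Longrightarrow> 0 < x v \<and> x v \<le> y v"
    and eq: "link_sum E x i = link_sum E y i"
    and w: "e \<in> E" "i \<in> e" "w \<in> e - {i}"
  shows "x w = y w"
proof (rule ccontr)
  assume "x w \<noteq> y w"
  then have lt: "x w < y w" using le[OF w] by simp
  have split: "(\<Prod>v\<in>e - {i}. f v) = f w * (\<Prod>v\<in>e - {i} - {w}. f v)" for f :: "'n \<Rightarrow> real"
    using w by (intro prod.remove) auto
  have "(\<Prod>v\<in>e - {i}. x v) < (\<Prod>v\<in>e - {i}. y v)"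
    unfolding split
  proof (rule mult_less_le_imp_less)
    show "(\<Prod>v\<in>e - {i} - {w}. x v) \<le> (\<Prod>v\<in>e - {i} - {w}. y v)"
      using le[OF w(1,2)] by (intro prod_mono) (auto simp: less_imp_le)
    show "0 < (\<Prod>v\<in>e - {i} - {w}. x v)"
      using le[OF w(1,2)] by (intro prod_pos) auto
  qed (use lt le[OF w] in auto)
  then have "link_sum E x i < link_sum E y i"
    unfolding link_sum_def using le w
    by (intro sum_strict_mono_ex1) (auto intro!: prod_mono simp: less_imp_le)
  with eq show False by simp
qed

lemma link_sum_pos:
  fixes x :: "'n::finite \<Rightarrow> real"
  assumes "\<And>v. 0 < x v" "e \<in> E" "i \<in> e"
  shows "0 < link_sum E x i"
  unfolding link_sum_def using assms by (intro sum_pos) (auto intro: prod_pos)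

lemma link_sum_scale:
  assumes "uniform_hypergraph k E"
  shows "link_sum E (\<lambda>v. c * x v) i = c ^ (k - 1) * link_sum E x i"
  unfolding link_sum_def sum_distrib_left
  using assms by (intro sum.cong) (auto simp: prod.distrib uniform_hypergraph_def)

lemma edge_sum_scale:
  assumes "uniform_hypergraph k E"
  shows "edge_sum E (\<lambda>v. c * x v) = c ^ k * edge_sum E x"
  unfolding edge_sum_def sum_distrib_left
  using assms by (intro sum.cong) (auto simp: prod.distrib uniform_hypergraph_def)

text \<open>Needed for the equality case: when the product of two inequalities is tight, so is the
  first of them.\<close>

lemma mult_eq_mult_imp_eq:
  fixes p q s t :: real
  assumes "0 < p" "0 < q" "p \<le> s" "q \<le> t" "p * q = s * t"
  shows "p = s"
  using mult_less_le_imp_less[of p s q t] assms by linarith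

text \<open>An edge contains \<open>i\<close> at most once, so the edge polynomial is affine in the
  variable at \<open>i\<close>; neither its slope \<open>link_sum E x i\<close> nor the remaining
  sum involves \<open>x i\<close>.\<close>

lemma edge_sum_upd:
  "edge_sum E (x(i := t)) = t * link_sum E x i + (\<Sum>e | e \<in> E \<and> i \<notin> e. \<Prod>v\<in>e. x v)"
proof -
  have "E = {e. e \<in> E \<and> i \<in> e} \<union> {e. e \<in> E \<and> i \<notin> e}" by auto
  then have "edge_sum E (x(i := t)) =
      (\<Sum>e | e \<in> E \<and> i \<in> e. \<Prod>v\<in>e. (x(i := t)) v) + (\<Sum>e | e \<in> E \<and> i \<notin> e. \<Prod>v\<in>e. (x(i := t)) v)"
    unfolding edge_sum_def by (subst sum.union_disjoint[symmetric]) auto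
  also have "(\<Sum>e | e \<in> E \<and> i \<in> e. \<Prod>v\<in>e. (x(i := t)) v) = t * link_sum E x i"
    unfolding link_sum_def sum_distrib_left
  proof (intro sum.cong refl)
    fix e assume "e \<in> {e. e \<in> E \<and> i \<in> e}"
    then have "(\<Prod>v\<in>e. (x(i := t)) v) = t * (\<Prod>v\<in>e - {i}. (x(i := t)) v)"
      by (subst prod.remove[of _ i]) auto
    then show "(\<Prod>v\<in>e. (x(i := t)) v) = t * (\<Prod>v\<in>e - {i}. x v)"
      by simp
  qed
  also have "(\<Sum>e | e \<in> E \<and> i \<notin> e. \<Prod>v\<in>e. (x(i := t)) v) = (\<Sum>e | e \<in> E \<and> i \<notin> e. \<Prod>v\<in>e. x v)"
    by (intro sum.cong prod.cong) auto
  finally show ?thesis .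
qed

section \<open>Action of the adjacency tensor\<close>

text \<open>The index lists with nonzero entry are the orderings of \<open>e - {i}\<close> for the
  edges \<open>e\<close> through \<open>i\<close>. Each edge yields \<open>fact (k - 1)\<close>
  equal terms, which cancels the normalization of the tensor.\<close>

lemma adjacency_tensor_apply:
  fixes x :: "complex ^ ('n::finite)"
  assumes "uniform_hypergraph k E" "k \<ge> 1"
  shows "(\<Sum>js | length js = k - 1. adjacency_tensor k E (i # js) * (\<Prod>j\<leftarrow>js. x $ j))
         = link_sum E (\<lambda>v. x $ v) i"
proof -
  define F where "F = {e. e \<in> E \<and> i \<in> e}"
  have fin: "finite {js :: 'n list. length js = k - 1}"
    using finite_lists_length_eq[of "UNIV :: 'n set" "k - 1"] by simp
  have card: "card (e - {i}) = k - 1" if "e \<in> F" for e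
    using that assms by (auto simp: F_def uniform_hypergraph_def)
  have supp: "{js. length js = k - 1 \<and> insert i (set js) \<in> E} = (\<Union>e\<in>F. permutations_of_set (e - {i}))"
  proof (intro equalityI subsetI)
    fix js assume "js \<in> {js. length js = k - 1 \<and> insert i (set js) \<in> E}"
    then have js: "length js = k - 1" "insert i (set js) \<in> E" by auto
    then have ck: "card (insert i (set js)) = k"
      using assms(1) by (auto simp: uniform_hypergraph_def)
    \<comment> \<open>The list has only \<open>k - 1\<close> entries but must form a
      \<open>k\<close>-set together with \<open>i\<close>, so \<open>i\<close> is new and no entry
      repeats.\<close>
    have "i \<notin> set js"
      using ck card_length[of js] js(1) assms(2) by (auto simp: insert_absorb)
    moreover from this have "distinct js"
      using ck js(1) assms(2) by (intro card_distinct) simp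
    ultimately have "js \<in> permutations_of_set (insert i (set js) - {i})"
      by (auto simp: permutations_of_set_def)
    with js(2) show "js \<in> (\<Union>e\<in>F. permutations_of_set (e - {i}))"
      by (auto simp: F_def)
  next
    fix js assume "js \<in> (\<Union>e\<in>F. permutations_of_set (e - {i}))"
    then obtain e where e: "e \<in> F" "set js = e - {i}" "distinct js"
      by (auto simp: permutations_of_set_def)
    then have "length js = k - 1" using card[of e] distinct_card[of js] by simp
    with e show "js \<in> {js. length js = k - 1 \<and> insert i (set js) \<in> E}"
      by (auto simp: F_def insert_absorb)
  qed
  have "(\<Sum>js | length js = k - 1. adjacency_tensor k E (i # js) * (\<Prod>j\<leftarrow>js. x $ j))
      = (\<Sum>js | length js = k - 1 \<and> insert i (set js) \<in> E. (\<Prod>j\<leftarrow>js. x $ j) / fact (k - 1))"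
    using assms(2) fin
    by (intro sum.mono_neutral_cong_right) (auto simp: adjacency_tensor_def)
  also have "\<dots> = (\<Sum>e\<in>F. \<Sum>js\<in>permutations_of_set (e - {i}). (\<Prod>j\<leftarrow>js. x $ j) / fact (k - 1))"
    unfolding supp
  proof (intro sum.UNION_disjoint ballI impI)
    fix e f assume "e \<in> F" "f \<in> F" "e \<noteq> f"
    then have "e - {i} \<noteq> f - {i}" by (auto simp: F_def)
    then show "permutations_of_set (e - {i}) \<inter> permutations_of_set (f - {i}) = {}"
      by (auto simp: permutations_of_set_def)
  qed auto
  also have "\<dots> = (\<Sum>e\<in>F. \<Prod>v\<in>e - {i}. x $ v)"
  proof (intro sum.cong refl)
    fix e assume e: "e \<in> F"
    have "(\<Sum>js\<in>permutations_of_set (e - {i}). (\<Prod>j\<leftarrow>js. x $ j) / fact (k - 1))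
        = (\<Sum>js\<in>permutations_of_set (e - {i}). (\<Prod>v\<in>e - {i}. x $ v) / fact (k - 1))"
      by (intro sum.cong refl)
         (auto simp: permutations_of_set_def simp flip: prod.distinct_set_conv_list)
    also have "\<dots> = (\<Prod>v\<in>e - {i}. x $ v)"
      by (simp only: sum_constant) (simp add: card[OF e])
    finally show "(\<Sum>js\<in>permutations_of_set (e - {i}). (\<Prod>j\<leftarrow>js. x $ j) / fact (k - 1))
        = (\<Prod>v\<in>e - {i}. x $ v)" .
  qed
  finally show ?thesis by (simp add: link_sum_def F_def)
qed

section \<open>Existence of a positive eigenvector\<close>

text \<open>The quotient of the two sums is homogeneous of degree 0, so its maximum over the nonzero
  nonnegative vectors is attained on the nonnegative part of the Euclidean unit sphere, which is
  compact.\<close>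

lemma edge_sum_maximizer_exists:
  fixes E :: "('n::finite) set set"
  assumes "uniform_hypergraph k E" "k \<ge> 1"
  obtains M x where "\<And>v. 0 \<le> x v" "\<exists>v. x v \<noteq> 0" "edge_sum E x = M * (\<Sum>v\<in>UNIV. x v ^ k)"
    "\<And>y. (\<And>v. 0 \<le> y v) \<Longrightarrow> edge_sum E y \<le> M * (\<Sum>v\<in>UNIV. y v ^ k)"
proof -
  define S where "S = sphere (0 :: real ^ 'n) 1 \<inter> {x. \<forall>i. 0 \<le> x $ i}"
  define f where "f = (\<lambda>x :: real ^ 'n. edge_sum E (\<lambda>v. x $ v) / (\<Sum>v\<in>UNIV. (x $ v) ^ k))"
  have pos: "(\<Sum>v\<in>UNIV. y v ^ k) > 0" if "\<And>v. 0 \<le> y v" "y w \<noteq> 0" for y :: "'n \<Rightarrow> real" and w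
    using that order.not_eq_order_implies_strict[OF _ that(1)[of w]]
    by (intro sum_pos2[of UNIV w]) auto
  have nz: "\<exists>w. x $ w \<noteq> 0" if "x \<in> S" for x
  proof -
    have "x \<noteq> 0" using that by (auto simp: S_def)
    then show ?thesis by (simp add: vec_eq_iff)
  qed
  have "closed {x :: real ^ 'n. \<forall>i. 0 \<le> x $ i}"
    by (intro closed_Collect_all closed_Collect_le continuous_intros)
  then have "compact S"
    unfolding S_def by (intro compact_Int_closed) auto
  moreover have "axis undefined 1 \<in> S"
    by (auto simp: S_def axis_def norm_axis_1[unfolded axis_def])
  moreover have "continuous_on S f"
    unfolding f_def edge_sum_def
  proof (intro continuous_intros ballI)
    fix x assume "x \<in> S"
    then show "(\<Sum>v\<in>UNIV. (x $ v) ^ k) \<noteq> 0"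
      using nz[of x] pos[of "\<lambda>v. x $ v"] by (auto simp: S_def)
  qed
  ultimately obtain z where z: "z \<in> S" "\<And>y. y \<in> S \<Longrightarrow> f y \<le> f z"
    using continuous_attains_sup[of S f] by blast
  show ?thesis
  proof (rule that[of "\<lambda>v. z $ v" "f z"])
    show "0 \<le> z $ v" for v using z(1) by (simp add: S_def)
    show "\<exists>v. z $ v \<noteq> 0" using nz z(1) by blast
    then have "(\<Sum>v\<in>UNIV. (z $ v) ^ k) > 0"
      using pos z(1) by (auto simp: S_def)
    then show "edge_sum E (\<lambda>v. z $ v) = f z * (\<Sum>v\<in>UNIV. (z $ v) ^ k)"
      by (simp add: f_def)
  next
    fix y :: "'n \<Rightarrow> real" assume y: "\<And>v. 0 \<le> y v"
    show "edge_sum E y \<le> f z * (\<Sum>v\<in>UNIV. y v ^ k)"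
    proof (cases "\<exists>w. y w \<noteq> 0")
      case False
      \<comment> \<open>Written as a multiple by 0 so that homogeneity gives edge sum 0.\<close>
      then have "y = (\<lambda>v. 0 * 0)" by auto
      then show ?thesis
        using assms(2) edge_sum_scale[OF assms(1), of 0 "\<lambda>_. 0"]
        by (simp add: power_0_left)
    next
      case True
      then have py: "(\<Sum>v\<in>UNIV. y v ^ k) > 0" using pos y by auto
      define c where "c = inverse (norm (\<chi> v. y v))"
      have ne: "(\<chi> v. y v) \<noteq> 0" using True by (auto simp: vec_eq_iff)
      then have c: "c > 0" by (simp add: c_def)
      have "c *\<^sub>R (\<chi> v. y v) \<in> S"
        using c y ne by (auto simp: S_def c_def)
      moreover have "(\<lambda>v. (c *\<^sub>R (\<chi> v. y v)) $ v) = (\<lambda>v. c * y v)" by simp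
      then have "f (c *\<^sub>R (\<chi> v. y v)) = edge_sum E (\<lambda>v. c * y v) / (\<Sum>v\<in>UNIV. (c * y v) ^ k)"
        by (simp only: f_def)
      then have "f (c *\<^sub>R (\<chi> v. y v)) = edge_sum E y / (\<Sum>v\<in>UNIV. y v ^ k)"
        using c by (simp add: edge_sum_scale[OF assms(1)] power_mult_distrib
            flip: sum_distrib_left)
      ultimately show ?thesis using z(2) py by (metis pos_divide_le_eq)
    qed
  qed
qed

text \<open>
  If a maximizer vanished on a set of vertices, connectedness would give an edge with \<open>m < k\<close>
  vertices inside that set and the others outside it. Raising the zero entries to \<open>t\<close>
  gains order \<open>t ^ m\<close> in the edge sum but costs only order \<open>t ^ k\<close>.
\<close>

lemma edge_sum_maximizer_pos:
  fixes E :: "('n::finite) set set" and x :: "'n \<Rightarrow> real"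
  assumes "uniform_hypergraph k E" "k \<ge> 1" "connected_hypergraph E"
    and x: "\<And>v. 0 \<le> x v" "\<exists>v. x v \<noteq> 0"
    and eq: "edge_sum E x = M * (\<Sum>v\<in>UNIV. x v ^ k)"
    and max: "\<And>y. (\<And>v. 0 \<le> y v) \<Longrightarrow> edge_sum E y \<le> M * (\<Sum>v\<in>UNIV. y v ^ k)"
  shows "0 < x v"
proof (rule ccontr)
  assume "\<not> 0 < x v"
  define S where "S = {v. x v = 0}"
  have "v \<in> S" using \<open>\<not> 0 < x v\<close> x(1)[of v] by (simp add: S_def)
  have "\<exists>u. u \<notin> S" using x(2) by (auto simp: S_def)
  \<comment> \<open>Otherwise \<open>S\<close> would be closed under adjacency and contain every
    vertex.\<close>
  then obtain e p q where e: "e \<in> E" "p \<in> e" "q \<in> e" "p \<in> S" "q \<notin> S"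
    using connected_hypergraph_closed_set[OF assms(3) \<open>v \<in> S\<close>] by metis
  define m where "m = card (e \<inter> S)"
  define c where "c = (\<Prod>v\<in>e - S. x v)"
  \<comment> \<open>The absolute value makes \<open>K\<close> nonnegative without deciding the sign
    of \<open>M\<close>.\<close>
  define K where "K = \<bar>M * card S\<bar>"
  have "c > 0" unfolding c_def
    using x(1) by (intro prod_pos) (auto simp: S_def order.strict_iff_order)
  have "m < card e" unfolding m_def using e by (intro psubset_card_mono) auto
  then have "m < k" using assms(1) e(1) by (auto simp: uniform_hypergraph_def)
  \<comment> \<open>The maximality inequality at \<open>y\<close> gives
    \<open>t ^ m * c \<le> K * t ^ k\<close>. Since \<open>m < k\<close> and
    \<open>t \<le> 1\<close>, a factor \<open>t\<close> survives division by
    \<open>t ^ m\<close>.\<close>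
  have bound: "c \<le> K * t" if t: "0 < t" "t \<le> 1" for t
  proof -
    define y where "y = (\<lambda>v. if v \<in> S then t else x v)"
    have y: "0 \<le> x v \<and> x v \<le> y v" for v using x t by (auto simp: y_def S_def)
    have ye: "(\<Prod>v\<in>e. y v) = t ^ m * c"
    proof -
      have "(\<Prod>v\<in>e. y v) = (\<Prod>v\<in>e \<inter> S. y v) * (\<Prod>v\<in>e - S. y v)"
        using prod.Int_Diff[of e y S] by simp
      then show ?thesis by (simp add: y_def m_def c_def)
    qed
    have "(\<Prod>v\<in>e. x v) = 0" using e by (auto simp: S_def)
    then have "edge_sum E x + t ^ m * c = (\<Sum>e\<in>E - {e}. \<Prod>v\<in>e. x v) + (\<Prod>v\<in>e. y v)"
      using e(1) ye by (simp add: edge_sum_def sum.remove)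
    also have "\<dots> \<le> (\<Sum>e\<in>E - {e}. \<Prod>v\<in>e. y v) + (\<Prod>v\<in>e. y v)"
      using y by (intro add_right_mono sum_mono prod_mono) auto
    also have "\<dots> = edge_sum E y"
      using e(1) by (simp add: edge_sum_def sum.remove)
    also have "\<dots> \<le> M * (\<Sum>v\<in>UNIV. y v ^ k)"
      by (intro max order_trans[OF x(1)]) (use y in blast)
    also have "(\<Sum>v\<in>UNIV. y v ^ k) = (\<Sum>v\<in>UNIV. x v ^ k + (if v \<in> S then t ^ k else 0))"
      using assms(2) by (intro sum.cong) (auto simp: y_def S_def)
    also have "\<dots> = (\<Sum>v\<in>UNIV. x v ^ k) + card S * t ^ k"
      by (simp add: sum.distrib sum.If_cases)
    finally have "t ^ m * c \<le> M * card S * t ^ k"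
      using eq by (simp add: algebra_simps)
    also have "\<dots> \<le> K * t ^ k"
      using t by (intro mult_right_mono) (auto simp: K_def)
    also have "t ^ k \<le> t ^ (m + 1)"
      using t \<open>m < k\<close> by (intro power_decreasing) auto
    then have "K * t ^ k \<le> K * t ^ (m + 1)"
      by (intro mult_left_mono) (auto simp: K_def)
    finally have "t ^ m * c \<le> t ^ m * (K * t)" by (simp add: algebra_simps)
    then show ?thesis using t by simp
  qed
  have "K \<ge> 0" by (simp add: K_def)
  \<comment> \<open>This explicit small \<open>t\<close> replaces a limit: it lies in the allowed
    range and makes \<open>K * t\<close> smaller than \<open>c\<close>.\<close>
  then have "c \<le> K * (c / (c + K))"
    using \<open>c > 0\<close> by (intro bound) auto
  then have "c * (c + K) \<le> K * c"
    using \<open>c > 0\<close> \<open>K \<ge> 0\<close> by (simp add: pos_le_divide_eq)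
  then have "c * c \<le> 0" by (simp add: algebra_simps)
  with \<open>c > 0\<close> show False by (simp add: mult_le_0_iff)
qed

text \<open>A positive maximizer is interior to the orthant, so all partial derivatives of the slack
  in the maximality inequality vanish there. This is the eigenvalue equation with
  \<open>r = M * k\<close>.\<close>

lemma perron_vector_exists:
  fixes E :: "('n::finite) set set"
  assumes "uniform_hypergraph k E" "k \<ge> 1" "connected_hypergraph E"
  obtains x :: "'n \<Rightarrow> real" and r
    where "\<And>v. 0 < x v" "\<And>i. link_sum E x i = r * x i ^ (k - 1)"
proof -
  obtain M x where x: "\<And>v. 0 \<le> x v" "\<exists>v. x v \<noteq> 0" "edge_sum E x = M * (\<Sum>v\<in>UNIV. x v ^ k)"
    and max: "\<And>y. (\<And>v. 0 \<le> y v) \<Longrightarrow> edge_sum E y \<le> M * (\<Sum>v\<in>UNIV. y v ^ k)"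
    using edge_sum_maximizer_exists[OF assms(1,2)] by metis
  have pos: "0 < x v" for v
    by (rule edge_sum_maximizer_pos[OF assms x max])
  have "link_sum E x i = (M * k) * x i ^ (k - 1)" for i
  proof -
    define C D where "C = (\<Sum>v\<in>UNIV - {i}. x v ^ k)" and "D = (\<Sum>e | e \<in> E \<and> i \<notin> e. \<Prod>v\<in>e. x v)"
    define h where "h = (\<lambda>t. M * (t ^ k + C) - (t * link_sum E x i + D))"
    have h: "h t = M * (\<Sum>v\<in>UNIV. (x(i := t)) v ^ k) - edge_sum E (x(i := t))" for t
    proof -
      have "(\<Sum>v\<in>UNIV. (x(i := t)) v ^ k) = t ^ k + (\<Sum>v\<in>UNIV - {i}. (x(i := t)) v ^ k)"
        by (subst sum.remove[of _ i]) auto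
      then show ?thesis by (simp add: h_def C_def D_def edge_sum_upd)
    qed
    have "(h has_real_derivative M * (k * x i ^ (k - 1)) - link_sum E x i) (at (x i))"
      unfolding h_def by (auto intro!: derivative_eq_intros)
    \<comment> \<open>The radius \<open>x i\<close> keeps \<open>t\<close> positive, so the modified
      vector stays in the orthant where maximality applies.\<close>
    moreover have "\<forall>t. \<bar>x i - t\<bar> < x i \<longrightarrow> h (x i) \<le> h t"
    proof (intro allI impI)
      fix t assume "\<bar>x i - t\<bar> < x i"
      then have "0 \<le> (x(i := t)) v" for v using x(1) by auto
      then have "0 \<le> h t" using max[of "x(i := t)"] by (simp only: h) simp
      moreover have "h (x i) = 0" using x(3) by (simp add: h)
      ultimately show "h (x i) \<le> h t" by simp
    qed
    ultimately have "M * (k * x i ^ (k - 1)) - link_sum E x i = 0"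
      using DERIV_local_min pos by blast
    then show ?thesis by simp
  qed
  with pos show ?thesis by (rule that)
qed

section \<open>The spectral radius\<close>

text \<open>At a vertex \<open>i\<close> maximizing \<open>cmod (z $ v) / x v\<close>, the triangle
  inequality bounds the eigenvalue equation of \<open>z\<close> by that of a multiple of
  \<open>x\<close> agreeing with the modulus of \<open>z\<close> at \<open>i\<close>.\<close>

lemma tensor_eigenvalue_le_perron:
  fixes E :: "('n::finite) set set" and x :: "'n \<Rightarrow> real"
  assumes "uniform_hypergraph k E" "k \<ge> 1"
    and x: "\<And>v. 0 < x v" "\<And>i. link_sum E x i = r * x i ^ (k - 1)"
    and "tensor_eigenvalue k (adjacency_tensor k E) l"
  shows "cmod l \<le> r"
proof -
  obtain z :: "complex ^ 'n" where z: "z \<noteq> 0"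
    "\<And>i. link_sum E (\<lambda>v. z $ v) i = l * (z $ i) ^ (k - 1)"
    using assms(5) unfolding tensor_eigenvalue_def adjacency_tensor_apply[OF assms(1,2)] by blast
  obtain w where w: "z $ w \<noteq> 0" using z(1) by (auto simp: vec_eq_iff)
  obtain i where i: "\<And>v. cmod (z $ v) / x v \<le> cmod (z $ i) / x i"
    using ex_is_arg_min_if_finite[of "UNIV :: 'n set" "\<lambda>v. - (cmod (z $ v) / x v)"]
    by (auto simp: is_arg_min_def not_less)
  define t where "t = cmod (z $ i) / x i"
  have le: "cmod (z $ v) \<le> t * x v" for v
    using i[of v] x(1)[of v] by (simp add: t_def pos_divide_le_eq)
  have zi: "cmod (z $ i) = t * x i" using x(1)[of i] by (simp add: t_def)
  have "0 < cmod (z $ w) / x w" using w x(1) by simp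
  then have t: "t > 0" using i[of w] by (simp add: t_def)
  have "cmod l * (t * x i) ^ (k - 1) = cmod (link_sum E (\<lambda>v. z $ v) i)"
    by (simp add: z(2) norm_mult norm_power zi)
  also have "\<dots> \<le> link_sum E (\<lambda>v. cmod (z $ v)) i"
    unfolding link_sum_def by (rule order_trans[OF norm_sum]) (simp add: prod_norm)
  also have "\<dots> \<le> link_sum E (\<lambda>v. t * x v) i"
    using le by (intro link_sum_mono) auto
  also have "\<dots> = r * (t * x i) ^ (k - 1)"
    by (simp add: link_sum_scale[OF assms(1)] x(2) power_mult_distrib)
  finally show ?thesis using t x(1)[of i] by simp
qed

text \<open>The vector \<open>x\<close>, read as complex, has eigenvalue \<open>r\<close>, and no
  eigenvalue has larger modulus; so the greatest modulus exists and equals \<open>r\<close>.\<close>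

lemma tensor_spectral_radius_eq_perron:
  fixes E :: "('n::finite) set set" and x :: "'n \<Rightarrow> real"
  assumes "uniform_hypergraph k E" "k \<ge> 1"
    and x: "\<And>v. 0 < x v" "\<And>i. link_sum E x i = r * x i ^ (k - 1)" and "0 \<le> r"
  shows "tensor_spectral_radius k (adjacency_tensor k E) = r"
  unfolding tensor_spectral_radius_def
proof (rule Greatest_equality)
  define z :: "complex ^ 'n" where "z = (\<chi> v. of_real (x v))"
  have "z $ undefined \<noteq> 0" using x(1)[of undefined] by (simp add: z_def)
  then have "z \<noteq> 0" by auto
  moreover have "link_sum E (\<lambda>v. z $ v) i = of_real r * (z $ i) ^ (k - 1)" for i
  proof -
    have "link_sum E (\<lambda>v. z $ v) i = of_real (link_sum E x i)"
      by (simp add: link_sum_def z_def)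
    then show ?thesis by (simp add: x(2) z_def)
  qed
  ultimately have "tensor_eigenvalue k (adjacency_tensor k E) (of_real r)"
    unfolding tensor_eigenvalue_def adjacency_tensor_apply[OF assms(1,2)] by blast
  then show "\<exists>l. tensor_eigenvalue k (adjacency_tensor k E) l \<and> r = cmod l"
    using \<open>0 \<le> r\<close> by (intro exI[of _ "of_real r"]) simp
qed (use tensor_eigenvalue_le_perron[OF assms(1,2) x] in blast)

section \<open>Comparing the Perron vector with the weights\<close>

text \<open>
  The relation \<open>le\<close> is either \<open>\<le>\<close> or \<open>\<ge>\<close>, so that the upper and the lower bound are
  obtained from one argument.
\<close>

lemma extremal_adjacent_pair:
  fixes E :: "('n::finite) set set" and x b :: "'n \<Rightarrow> real" and le :: "real \<Rightarrow> real \<Rightarrow> bool"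
  assumes le: "le = (\<le>) \<or> le = (\<ge>)"
    and uni: "uniform_hypergraph k E" and k: "k \<ge> 3"
    and con: "connected_hypergraph E" and ne: "E \<noteq> {}"
    and x: "\<And>v. 0 < x v" "\<And>i. link_sum E x i = r * x i ^ (k - 1)"
    and b: "\<And>v. 0 < b v"
  defines "d \<equiv> weighted_degree k E b"
  obtains e i j where "e \<in> E" "i \<in> e" "j \<in> e" "i \<noteq> j" "le r (sqrt (d i * d j))"
    "(\<forall>e\<in>E. \<forall>p\<in>e. \<forall>q\<in>e. p \<noteq> q \<longrightarrow> le (sqrt (d p * d q)) r) \<longrightarrow> (\<forall>u. d u = r)"
proof -
  define y where "y = (\<lambda>v. x v / b v)"
  define m where "m = k - 1"
  have y: "0 < y v" for v using x(1) b by (simp add: y_def)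
  have card: "card e = k" if "e \<in> E" for e using uni that by (simp add: uniform_hypergraph_def)
  have cov: "\<exists>e\<in>E. u \<in> e" for u
    using connected_hypergraph_vertex_covered[OF con ne, of u] card k by fastforce
  have d: "link_sum E b u = d u * b u ^ m" for u
    using b[of u] by (simp add: d_def m_def weighted_degree_def link_sum_def)
  have dpos: "0 < d u" for u
    using cov[of u] link_sum_pos[of b _ E u] b[of u] b d[of u] zero_less_power[OF b[of u], of m]
    by (metis zero_less_mult_pos2)
  have rpos: "0 < r"
  proof -
    fix u
    show ?thesis
      using cov[of u] link_sum_pos[of x _ E u] x zero_less_power[OF x(1)[of u], of "k - 1"]
      by (metis zero_less_mult_pos2)
  qed
  have xy: "x v = y v * b v" for v using b[of v] by (simp add: y_def)
  \<comment> \<open>Both expressions carry the factor \<open>b u ^ m\<close>; cancelling it turns a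
    comparison of \<open>x\<close> with \<open>c * b\<close> around \<open>u\<close> into one of
    \<open>y u\<close> with \<open>c\<close>.\<close>
  have sums: "link_sum E x u = r * y u ^ m * b u ^ m"
    "link_sum E (\<lambda>v. c * b v) u = d u * c ^ m * b u ^ m" for u c
    by (simp_all add: x(2) xy[of u] m_def power_mult_distrib link_sum_scale[OF uni] d)
  \<comment> \<open>The constant \<open>c\<close> bounds \<open>y\<close> on all neighbours of
    \<open>u\<close>. If the resulting inequality is tight, \<open>y\<close> equals \<open>c\<close>
    on all of them.\<close>
  have step: "le (r * y u ^ m) (d u * c ^ m)"
    "r * y u ^ m = d u * c ^ m \<Longrightarrow> e \<in> E \<Longrightarrow> u \<in> e \<Longrightarrow> w \<in> e \<Longrightarrow> w \<noteq> u \<Longrightarrow> y w = c"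
    if c: "0 < c" and nbr: "\<And>e v. e \<in> E \<Longrightarrow> u \<in> e \<Longrightarrow> v \<in> e \<Longrightarrow> v \<noteq> u \<Longrightarrow> le (y v) c" for u c e w
  proof -
    have bu: "0 < b u ^ m" using b by simp
    have nbr': "le (x v) (c * b v)" if "e \<in> E" "u \<in> e" "v \<in> e - {u}" for e v
      using nbr[of e v] that le b[of v] by (auto simp: xy)
    have "le (link_sum E x u) (link_sum E (\<lambda>v. c * b v) u)"
      using le
    proof
      assume "le = (\<le>)"
      then show ?thesis using nbr' x(1) by (auto intro!: link_sum_mono simp: less_imp_le)
    next
      assume "le = (\<ge>)"
      then show ?thesis using nbr' b c by (auto intro!: link_sum_mono simp: less_imp_le)
    qed
    then show "le (r * y u ^ m) (d u * c ^ m)"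
      unfolding sums using le bu by auto
    assume eq: "r * y u ^ m = d u * c ^ m" and e: "e \<in> E" "u \<in> e" "w \<in> e" "w \<noteq> u"
    have eq': "link_sum E x u = link_sum E (\<lambda>v. c * b v) u"
      by (simp add: sums eq)
    have "x w = c * b w"
      using le
    proof
      assume "le = (\<le>)"
      then show ?thesis
        using link_sum_eq_imp_eq[OF _ eq', of e w] nbr' x(1) e by auto
    next
      assume "le = (\<ge>)"
      then show ?thesis
        using link_sum_eq_imp_eq[OF _ eq'[symmetric], of e w] nbr' b c e by auto
    qed
    then show "y w = c" using b[of w] by (simp add: xy)
  qed
  have extreme: "\<exists>i\<in>A. \<forall>v\<in>A. le (y v) (y i)" if "A \<noteq> {}" for A
    using le ex_is_arg_min_if_finite[of A "\<lambda>v. - y v"] ex_is_arg_min_if_finite[of A y] that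
    by (auto simp: is_arg_min_def not_less)
  have third: "\<exists>w\<in>e. w \<noteq> p \<and> w \<noteq> q" if "e \<in> E" for e p q
  proof (rule ccontr)
    assume "\<not> ?thesis"
    then have "card e \<le> card {p, q}" by (intro card_mono) auto
    also have "\<dots> \<le> 2" by (simp add: card_insert_if)
    finally show False using card[OF that] k by simp
  qed
  \<comment> \<open>Stated for every vertex \<open>i\<close> at which \<open>y\<close> is extremal,
    so that it can be reapplied as the extremal value spreads in the equality case.\<close>
  have pair: "\<exists>e\<in>E. i \<in> e \<and> (\<exists>j\<in>e. i \<noteq> j \<and> le r (sqrt (d i * d j)) \<and>
      (r = sqrt (d i * d j) \<longrightarrow> d i = r \<and> (\<forall>f\<in>E. i \<in> f \<longrightarrow> (\<forall>w\<in>f. y w = y i))))"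
    if i: "\<And>v. le (y v) (y i)" for i
  proof -
    define N where "N = {v. v \<noteq> i \<and> (\<exists>e\<in>E. i \<in> e \<and> v \<in> e)}"
    have "N \<noteq> {}" using cov[of i] third[of _ i i] by (auto simp: N_def)
    then obtain j where "j \<in> N" and j: "\<And>v. v \<in> N \<Longrightarrow> le (y v) (y j)" using extreme[of N] by blast
    then obtain e where e: "e \<in> E" "i \<in> e" "j \<in> e" "i \<noteq> j" by (auto simp: N_def)
    \<comment> \<open>At \<open>i\<close> the constant is \<open>y j\<close>, extremal among the
      neighbours of \<open>i\<close>; at \<open>j\<close> it is \<open>y i\<close>, extremal among
      all vertices. In the product of the two inequalities the powers of \<open>y\<close> cancel as
      \<open>P\<close>.\<close>
    have si: "le (r * y i ^ m) (d i * y j ^ m)"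
      using j by (intro step y) (auto simp: N_def)
    have sj: "le (r * y j ^ m) (d j * y i ^ m)"
      using i by (intro step y) auto
    define P where "P = y i ^ m * y j ^ m"
    have P: "P > 0" using y by (simp add: P_def)
    have prods: "(r * y i ^ m) * (r * y j ^ m) = r\<^sup>2 * P"
      "(d i * y j ^ m) * (d j * y i ^ m) = (d i * d j) * P"
      by (simp_all add: P_def power2_eq_square mult_ac)
    have pos: "0 < r * y u ^ m" "0 < d u * y v ^ m" for u v using rpos dpos y by simp_all
    have "le ((r * y i ^ m) * (r * y j ^ m)) ((d i * y j ^ m) * (d j * y i ^ m))"
      using le
    proof
      assume "le = (\<le>)"
      then show ?thesis
        using mult_mono[of _ _ "r * y j ^ m" "d j * y i ^ m"] si sj
          less_imp_le[OF pos(1)] less_imp_le[OF pos(2)] by auto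
    next
      assume "le = (\<ge>)"
      then show ?thesis
        using mult_mono[of _ _ "d j * y i ^ m" "r * y j ^ m"] si sj
          less_imp_le[OF pos(1)] less_imp_le[OF pos(2)] by auto
    qed
    then have "le (r\<^sup>2) (d i * d j)"
      unfolding prods using le P by auto
    then have bound: "le r (sqrt (d i * d j))"
      using le rpos by (auto intro: real_le_rsqrt real_le_lsqrt)
    have tight: "d i = r \<and> (\<forall>f\<in>E. i \<in> f \<longrightarrow> (\<forall>w\<in>f. y w = y i))" if "r = sqrt (d i * d j)"
    proof -
      have "r\<^sup>2 = d i * d j" using that dpos[of i] dpos[of j] by simp
      then have eq: "(r * y i ^ m) * (r * y j ^ m) = (d i * y j ^ m) * (d j * y i ^ m)"
        unfolding prods by simp
      \<comment> \<open>All factors are positive, so equality of the products forces equality in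
        \<open>si\<close>, and then in \<open>sj\<close>.\<close>
      have eqi: "r * y i ^ m = d i * y j ^ m"
        using le
      proof
        assume "le = (\<le>)"
        then show ?thesis
          using mult_eq_mult_imp_eq[OF pos(1) pos(1) _ _ eq] si sj by simp
      next
        assume "le = (\<ge>)"
        then show ?thesis
          using mult_eq_mult_imp_eq[OF pos(2) pos(2) _ _ eq[symmetric]] si sj by simp
      qed
      then have eqj: "r * y j ^ m = d j * y i ^ m"
        using eq pos(2)[of i j] by (metis mult_left_cancel less_irrefl)
      have ni: "y w = y j" if "f \<in> E" "i \<in> f" "w \<in> f" "w \<noteq> i" for f w
        using step(2)[OF y _ eqi that] j by (auto simp: N_def)
      have nj: "y w = y i" if "f \<in> E" "j \<in> f" "w \<in> f" "w \<noteq> j" for f w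
        using step(2)[OF y _ eqj that] i by auto
      \<comment> \<open>Here \<open>k \<ge> 3\<close> is essential: a third vertex of \<open>e\<close> is adjacent to both \<open>i\<close> and \<open>j\<close>.\<close>
      obtain w where "w \<in> e" "w \<noteq> i" "w \<noteq> j" using third[OF e(1)] by blast
      then have yij: "y j = y i" using ni[OF e(1,2)] nj[OF e(1,3)] by metis
      then have "d i = r" using eqi y[of i] by simp
      with ni yij show ?thesis by metis
    qed
    from e bound tight show ?thesis by blast
  qed
  obtain i where i: "\<And>v. le (y v) (y i)" using extreme[of UNIV] by auto
  obtain e j where e: "e \<in> E" "i \<in> e" "j \<in> e" "i \<noteq> j" "le r (sqrt (d i * d j))"
    using pair[OF i] by blast
  have "(\<forall>e\<in>E. \<forall>p\<in>e. \<forall>q\<in>e. p \<noteq> q \<longrightarrow> le (sqrt (d p * d q)) r) \<longrightarrow> (\<forall>u. d u = r)"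
  proof
    assume all: "\<forall>e\<in>E. \<forall>p\<in>e. \<forall>q\<in>e. p \<noteq> q \<longrightarrow> le (sqrt (d p * d q)) r"
    have antisym: "s = t" if "le s t" "le t s" for s t using le that by auto
    have tight: "d u = r \<and> (\<forall>f\<in>E. u \<in> f \<longrightarrow> (\<forall>w\<in>f. y w = y u))" if "y u = y i" for u
    proof -
      have "\<And>v. le (y v) (y u)" using i that by simp
      from pair[OF this] all antisym show ?thesis by metis
    qed
    \<comment> \<open>Tightness at a vertex with extremal \<open>y\<close> makes its neighbours
      extremal too, so the extremal set is closed under adjacency.\<close>
    have "u \<in> {u. y u = y i}" for u
    proof (rule connected_hypergraph_closed_set[OF con, of i])
      fix f v w assume "f \<in> E" "v \<in> f" "w \<in> f" and v: "v \<in> {u. y u = y i}"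
      then have "y w = y v" using tight[of v] by blast
      with v show "w \<in> {u. y u = y i}" by simp
    qed simp
    then show "\<forall>u. d u = r" using tight by blast
  qed
  with e show ?thesis by (rule that)
qed

section \<open>The bounds and their equality case\<close>

theorem theorem3p2:
  fixes k :: nat and E :: "('n::finite) set set" and b b' :: "'n \<Rightarrow> real"
  defines "b' \<equiv> weighted_degree k E b"
  assumes "k \<ge> 3"
    and "uniform_hypergraph k E"
    and "connected_hypergraph E"
    and "E \<noteq> {}"
    and "\<And>i. b i > 0"
  shows "(MIN e\<in>E. Min {sqrt (b' i * b' j) | i j. i \<noteq> j \<and> {i, j} \<subseteq> e})
           \<le> tensor_spectral_radius k (adjacency_tensor k E) \<and>
         tensor_spectral_radius k (adjacency_tensor k E)
           \<le> (MAX e\<in>E. Max {sqrt (b' i * b' j) | i j. i \<noteq> j \<and> {i, j} \<subseteq> e}) \<and>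
         (((MIN e\<in>E. Min {sqrt (b' i * b' j) | i j. i \<noteq> j \<and> {i, j} \<subseteq> e})
             = tensor_spectral_radius k (adjacency_tensor k E) \<or>
           tensor_spectral_radius k (adjacency_tensor k E)
             = (MAX e\<in>E. Max {sqrt (b' i * b' j) | i j. i \<noteq> j \<and> {i, j} \<subseteq> e}))
          \<longleftrightarrow> (\<forall>i j. b' i = b' j))"
proof -
  have k1: "k \<ge> 1" using \<open>k \<ge> 3\<close> by simp
  define V where "V e = {sqrt (b' i * b' j) | i j. i \<noteq> j \<and> {i, j} \<subseteq> e}" for e
  define lo hi where "lo = (MIN e\<in>E. Min (V e))" and "hi = (MAX e\<in>E. Max (V e))"
  have V: "finite (V e)" "e \<in> E \<Longrightarrow> V e \<noteq> {}" for e
  proof -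
    have "V e \<subseteq> (\<lambda>(i, j). sqrt (b' i * b' j)) ` UNIV" by (auto simp: V_def)
    then show "finite (V e)" by (rule finite_subset) simp
    assume "e \<in> E"
    then have "\<not> card e \<le> Suc 0" using assms(2,3) by (auto simp: uniform_hypergraph_def)
    then obtain i j where "i \<in> e" "j \<in> e" "i \<noteq> j"
      using card_le_Suc0_iff_eq[of e] by auto
    then show "V e \<noteq> {}" by (auto simp: V_def)
  qed
  have adj: "lo \<le> sqrt (b' i * b' j) \<and> sqrt (b' i * b' j) \<le> hi"
    if "e \<in> E" "i \<in> e" "j \<in> e" "i \<noteq> j" for e i j
  proof -
    have mem: "sqrt (b' i * b' j) \<in> V e" using that by (auto simp: V_def)
    have "lo \<le> Min (V e)" "Max (V e) \<le> hi" unfolding lo_def hi_def using that(1) by auto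
    with mem Min_le[OF V(1) mem] Max_ge[OF V(1) mem] show ?thesis by linarith
  qed
  obtain x :: "'n \<Rightarrow> real" and r
    where x: "\<And>v. 0 < x v" "\<And>i. link_sum E x i = r * x i ^ (k - 1)"
    using perron_vector_exists[OF assms(3) k1 assms(4)] by blast
  obtain e where "e \<in> E" using \<open>E \<noteq> {}\<close> by blast
  moreover from V(2)[OF this] obtain u where "u \<in> e" by (auto simp: V_def)
  ultimately have "0 < r * x u ^ (k - 1)"
    using link_sum_pos[of x e E u] x by metis
  then have "0 < r" by (rule zero_less_mult_pos2) (simp add: x(1))
  then have rho: "tensor_spectral_radius k (adjacency_tensor k E) = r"
    by (intro tensor_spectral_radius_eq_perron[OF assms(3) k1 x]) simp
  have upper: "r \<le> hi" "r = hi \<Longrightarrow> \<forall>u. b' u = r"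
  proof -
    obtain e i j where *: "e \<in> E" "i \<in> e" "j \<in> e" "i \<noteq> j" "r \<le> sqrt (b' i * b' j)"
      and **: "(\<forall>e\<in>E. \<forall>p\<in>e. \<forall>q\<in>e. p \<noteq> q \<longrightarrow> sqrt (b' p * b' q) \<le> r) \<longrightarrow> (\<forall>u. b' u = r)"
      by (rule extremal_adjacent_pair[where x = x and b = b, OF disjI1[OF refl] assms(3,2,4,5) x assms(6), folded b'_def])
         (rule that)
    \<comment> \<open>Every adjacent pair has value at most \<open>hi\<close>, so
      \<open>r = hi\<close> supplies the premise of \<open>**\<close>.\<close>
    show "\<forall>u. b' u = r" if "r = hi"
      using ** adj unfolding that by blast
    from *(5) adj[OF *(1-4)] show "r \<le> hi" by linarith
  qed
  have lower: "lo \<le> r" "lo = r \<Longrightarrow> \<forall>u. b' u = r"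
  proof -
    obtain e i j where *: "e \<in> E" "i \<in> e" "j \<in> e" "i \<noteq> j" "r \<ge> sqrt (b' i * b' j)"
      and **: "(\<forall>e\<in>E. \<forall>p\<in>e. \<forall>q\<in>e. p \<noteq> q \<longrightarrow> sqrt (b' p * b' q) \<ge> r) \<longrightarrow> (\<forall>u. b' u = r)"
      by (rule extremal_adjacent_pair[where x = x and b = b, OF disjI2[OF refl] assms(3,2,4,5) x assms(6), folded b'_def])
         (rule that)
    show "\<forall>u. b' u = r" if "lo = r"
      using ** adj unfolding that by blast
    from *(5) adj[OF *(1-4)] show "lo \<le> r" by linarith
  qed
  \<comment> \<open>For constant \<open>b'\<close> every \<open>V e\<close> is the same singleton,
    so \<open>lo\<close> and \<open>hi\<close> coincide and squeeze \<open>r\<close>.\<close>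
  have const: "r = hi" if all: "\<forall>i j. b' i = b' j"
  proof -
    have "b' i \<ge> 0" for i
      using assms(6) unfolding b'_def weighted_degree_def
      by (auto intro!: mult_nonneg_nonneg sum_nonneg prod_nonneg simp: less_imp_le)
    then have "sqrt (b' i * b' j) = b' u" for i j
      using all[rule_format, of i u] all[rule_format, of j u] by simp
    then have "V e = {b' u}" if "e \<in> E" for e
      using V(2)[OF that] by (auto simp: V_def)
    then have "lo = b' u" "hi = b' u"
      using \<open>E \<noteq> {}\<close> by (simp_all add: lo_def hi_def)
    then show ?thesis using upper(1) lower(1) by simp
  qed
  show ?thesis
    unfolding rho V_def[symmetric] lo_def[symmetric] hi_def[symmetric]
    using upper lower const by (metis (no_types))
qed

end
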